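(* Let $G$ be a finite group. Then $d_I(G)=\log_2|G|$ if and only if $G$ is an elementary abelian $2$-group.
   Context: For a finite group $G$ and $s,g\in G$ write $s^g=g^{-1}sg$. A subset $S\subseteq G$ invariably generates $G$ if $G=\langle s^{g(s)}\mid s\in S\rangle$ for every choice of elements $g(s)\in G$, $s\in S$. Define $d_I(G)=\min\{|S| : S\subseteq G \text{ invariably generates } G\}$ (the empty set invariably generates the trivial group). The trivial group is regarded as an elementary abelian $2$-group. *)

theory Defs
  imports Complex_Main "HOL-Algebra.Algebra"
begin

definition group_conj :: "('a, 'b) monoid_scheme \<Rightarrow> 'a \<Rightarrow> 'a \<Rightarrow> 'a" where
  "group_conj G s g = inv\<^bsub>G\<^esub> g \<otimes>\<^bsub>G\<^esub> s \<otimes>\<^bsub>G\<^esub> g"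

definition invariably_generates :: "('a, 'b) monoid_scheme \<Rightarrow> 'a set \<Rightarrow> bool" where
  "invariably_generates G S \<longleftrightarrow>
     S \<subseteq> carrier G \<and>
     (\<forall>g \<in> S \<rightarrow> carrier G. generate G ((\<lambda>s. group_conj G s (g s)) ` S) = carrier G)"

(* Intended for finite G. There the minimum exists: by Jordan's theorem no proper subgroup
   of a finite group meets every conjugacy class, so carrier G invariably generates G. *)
definition d_I :: "('a, 'b) monoid_scheme \<Rightarrow> nat" where
  "d_I G = (LEAST n. \<exists>S. invariably_generates G S \<and> card S = n)"

(* The trivial group qualifies, for every prime p. *)
definition elementary_abelian :: "nat \<Rightarrow> ('a, 'b) monoid_scheme \<Rightarrow> bool" where
  "elementary_abelian p G \<longleftrightarrow>
     Factorial_Ring.prime p \<and> comm_group G \<and> (\<forall>x \<in> carrier G. x \<noteq> \<one>\<^bsub>G\<^esub> \<longrightarrow> group.ord G x = p)"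

end

theory Submission
  imports Defs
begin

text \<open>If \<open>d_I G = log 2 |G|\<close> then \<open>|G|\<close> is a power of two, because \<open>d_I G\<close> is a natural number.
  So only 2-groups matter. There maximal subgroups are normal, hence every generating set already
  generates invariably. Adding generators one at a time at least doubles the generated subgroup;
  starting from an element of order at least 4 saves one generator, so such an element cannot
  exist.\<close>

section \<open>Growth of generated subgroups\<close>

text \<open>With K the old subgroup, the coset \<open>K #> x\<close> is disjoint from K, has as many
  elements, and lies in the new subgroup.\<close>

lemma generate_doubling:
  fixes G (structure)
  assumes "group G" "finite (carrier G)" "S \<subseteq> carrier G" "x \<in> carrier G" "x \<notin> generate G S"
  shows "2 * card (generate G S) \<le> card (generate G (insert x S))"
proof -
  interpret group G by fact
  let ?K = "generate G S" and ?L = "generate G (insert x S)"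
  have sL: "subgroup ?L G" and sK: "subgroup ?K G"
    using assms by (simp_all add: generate_is_subgroup)
  have KL: "?K \<subseteq> ?L" by (rule mono_generate) auto
  have xL: "x \<in> ?L" by (simp add: generate.incl)
  have fL: "finite ?L" using assms(2) sL finite_subset subgroup.subset by blast
  have fK: "finite ?K" using fL KL finite_subset by blast
  interpret K: subgroup ?K G by fact
  interpret L: subgroup ?L G by fact
  have "?K #> x \<subseteq> ?L" using KL xL by (auto simp: r_coset_def)
  moreover have "?K \<inter> (?K #> x) = {}"
  proof (rule ccontr)
    assume "?K \<inter> (?K #> x) \<noteq> {}"
    then obtain k where k: "k \<in> ?K" "k \<otimes> x \<in> ?K" by (auto simp: r_coset_def)
    then have "inv k \<otimes> (k \<otimes> x) \<in> ?K" by simp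
    then show False using k assms(4,5) by (simp add: m_assoc[symmetric])
  qed
  moreover have "card (?K #> x) = card ?K"
    using card_cosets_equal[OF rcosetsI[OF K.subset assms(4)] K.subset]
    by (metis bij_betw_same_card)
  moreover have "finite (?K #> x)" using fK by (simp add: r_coset_def)
  ultimately have "card ?K + card ?K = card (?K \<union> (?K #> x))"
    using fK by (simp add: card_Un_disjoint)
  also have "\<dots> \<le> card ?L" using fL KL \<open>?K #> x \<subseteq> ?L\<close> by (intro card_mono) auto
  finally show ?thesis by simp
qed

text \<open>By doubling, the quotient of \<open>2 ^ card S\<close> by
  \<open>card (generate G S)\<close> never increases when an element outside the generated subgroup
  is added; the inequality is this with denominators cleared. Starting from the empty set it bounds
  \<open>card S\<close> by the logarithm of the order. Starting from one element of order at least 4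
  it saves a generator.\<close>

lemma extend_to_generating_set:
  fixes G (structure)
  assumes G: "group G" "finite (carrier G)" and S0: "S0 \<subseteq> carrier G"
  shows "\<exists>S \<subseteq> carrier G. generate G S = carrier G \<and>
           2 ^ card S * card (generate G S0) \<le> 2 ^ card S0 * order G"
  using S0
proof (induction "order G - card (generate G S0)" arbitrary: S0 rule: less_induct)
  case less
  interpret group G by fact
  have sub: "generate G S0 \<subseteq> carrier G" using less.prems by (rule generate_incl)
  show ?case
  proof (cases "generate G S0 = carrier G")
    case True
    then show ?thesis using less.prems by (auto simp: order_def)
  next
    case False
    then obtain x where x: "x \<in> carrier G" "x \<notin> generate G S0" using sub by blast
    let ?S1 = "insert x S0"
    have S1: "?S1 \<subseteq> carrier G" using x less.prems by simp
    have dbl: "2 * card (generate G S0) \<le> card (generate G ?S1)"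
      using generate_doubling[OF G less.prems x] .
    \<comment> \<open>Doubling is strict growth only from a positive size; the induction measure
      needs it to be strict.\<close>
    have pos: "card (generate G S0) > 0"
      using generate.one[of G S0] sub G(2) by (metis card_gt_0_iff empty_iff finite_subset)
    have le: "card (generate G ?S1) \<le> order G"
      unfolding order_def using G(2) generate_incl[OF S1] by (rule card_mono)
    have "order G - card (generate G ?S1) < order G - card (generate G S0)"
      using dbl pos le by linarith
    from less.hyps[OF this S1] obtain S where S: "S \<subseteq> carrier G" "generate G S = carrier G"
      "2 ^ card S * card (generate G ?S1) \<le> 2 ^ card ?S1 * order G" by blast
    have "x \<notin> S0" using x(2) generate.incl by metis
    then have c: "card ?S1 = Suc (card S0)"
      using less.prems G(2) by (simp add: finite_subset)
    have "2 * (2 ^ card S * card (generate G S0)) \<le> 2 ^ card S * card (generate G ?S1)"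
      using mult_le_mono2[OF dbl, of "2 ^ card S"] by (simp add: mult_ac)
    also have "\<dots> \<le> 2 * (2 ^ card S0 * order G)" using S(3) c by simp
    finally show ?thesis using S(1,2) by auto
  qed
qed

section \<open>Normalizers and maximal subgroups in p-groups\<close>

text \<open>Right multiplication reverses products, so the inverse is inserted to obtain a
  homomorphism. The map is restricted to the cosets because \<open>BijGroup\<close> consists of
  extensional functions.\<close>

lemma group_action_on_rcosets:
  fixes G (structure)
  assumes "group G" and H: "subgroup H G"
  shows "group_action (G\<lparr>carrier := H\<rparr>) (rcosets H) (\<lambda>h. \<lambda>C \<in> rcosets H. C #> inv h)"
proof -
  interpret group G by fact
  interpret H: subgroup H G by fact
  let ?\<phi> = "\<lambda>h. \<lambda>C \<in> rcosets H. C #> inv h"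
  have closed: "C #> g \<in> rcosets H" if "C \<in> rcosets H" "g \<in> carrier G" for C g
    using that by (auto simp: RCOSETS_def coset_mult_assoc H.subset)
  have assoc: "(C #> g) #> g' = C #> (g \<otimes> g')"
    if "C \<in> rcosets H" "g \<in> carrier G" "g' \<in> carrier G" for C g g'
    using that H.rcosets_carrier coset_mult_assoc[of C g g'] by auto
  have one: "C #> \<one> = C" if "C \<in> rcosets H" for C
    using that H.rcosets_carrier by (simp add: coset_mult_one)
  have bij: "?\<phi> h \<in> carrier (BijGroup (rcosets H))" if h: "h \<in> H" for h
  proof -
    have "bij_betw (?\<phi> h) (rcosets H) (rcosets H)"
      by (rule bij_betw_byWitness[where f' = "\<lambda>C. C #> h"])
         (use h closed assoc one in auto)
    then show ?thesis by (simp add: BijGroup_def Bij_def)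
  qed
  have "?\<phi> \<in> hom (G\<lparr>carrier := H\<rparr>) (BijGroup (rcosets H))"
  proof (rule homI)
    fix h k assume hk: "h \<in> carrier (G\<lparr>carrier := H\<rparr>)" "k \<in> carrier (G\<lparr>carrier := H\<rparr>)"
    then have "?\<phi> (h \<otimes> k) = compose (rcosets H) (?\<phi> h) (?\<phi> k)"
      using closed assoc by (auto simp: compose_def fun_eq_iff inv_mult_group)
    then show "?\<phi> (h \<otimes>\<^bsub>G\<lparr>carrier := H\<rparr>\<^esub> k) = ?\<phi> h \<otimes>\<^bsub>BijGroup (rcosets H)\<^esub> ?\<phi> k"
      using hk bij by (simp add: BijGroup_def)
  qed (use bij in simp)
  then show ?thesis
    by (simp add: group_action_def group_hom_def group_hom_axioms_def group_BijGroup
        subgroup_imp_group H)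
qed

lemma dvd_prime_power_cases:
  fixes p q :: nat
  assumes "Factorial_Ring.prime p" "q dvd p ^ n"
  shows "q = 1 \<or> p dvd q"
proof -
  obtain i where "q = p ^ i" using assms by (auto simp: divides_primepow_nat)
  then show ?thesis by (cases i) auto
qed

lemma proper_subgroup_less_normalizer:
  fixes G (structure)
  assumes "group G" and ord: "order G = p ^ n" and p: "Factorial_Ring.prime p"
    and H: "subgroup H G" "H \<noteq> carrier G"
  shows "H \<subset> normalizer G H"
proof -
  interpret group G by fact
  interpret H: subgroup H G by fact
  \<comment> \<open>\<open>order\<close> is 0 on an infinite carrier, whereas a power of a prime is
    positive.\<close>
  have fin: "finite (carrier G)"
    using ord p order_gt_0_iff_finite prime_gt_0_nat by (metis zero_less_power)
  have fH: "finite H" using fin H.subset finite_subset by blast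
  let ?H = "G\<lparr>carrier := H\<rparr>" and ?\<phi> = "\<lambda>h. \<lambda>C \<in> rcosets H. C #> inv h"
  interpret A: group_action ?H "rcosets H" ?\<phi>
    using group_action_on_rcosets[OF assms(1) H(1)] .
  have lag: "card (rcosets H) * card H = p ^ n"
    using lagrange[OF H(1)] ord by simp
  have finR: "finite (rcosets H)"
    using fin H.subset rcosets_subset_PowG[OF H(1)] by (meson finite_Pow_iff finite_subset)
  \<comment> \<open>\<open>H\<close> is proper, so its index is a power of \<open>p\<close> other
    than 1 and hence divisible by \<open>p\<close>.\<close>
  have "card (rcosets H) \<noteq> 1"
  proof
    assume "card (rcosets H) = 1"
    then have "card H = card (carrier G)" using lag ord by (simp add: order_def)
    then show False using fin H(2) H.subset card_subset_eq by blast
  qed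
  moreover have "card (rcosets H) dvd p ^ n" using lag dvd_triv_left by metis
  ultimately have pdvd: "p dvd card (rcosets H)"
    using dvd_prime_power_cases[OF p] by blast
  \<comment> \<open>\<open>H\<close> acts on its cosets with orbits of \<open>p\<close>-power size. The coset \<open>H\<close> is fixed, so there is
    another fixed coset \<open>H #> g\<close>, and then \<open>g\<close> normalizes \<open>H\<close>.\<close>
  have orbdvd: "card (orbit ?H ?\<phi> C) = 1 \<or> p dvd card (orbit ?H ?\<phi> C)"
    if "C \<in> rcosets H" for C
  proof -
    have "card (orbit ?H ?\<phi> C) * card (stabilizer ?H ?\<phi> C) = card H"
      using A.orbit_stabilizer_theorem[OF that] by (simp add: order_def)
    then have "card (orbit ?H ?\<phi> C) dvd card H" by (rule dvdI[OF sym])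
    also have "card H dvd p ^ n" unfolding lag[symmetric] by simp
    finally have "card (orbit ?H ?\<phi> C) dvd p ^ n" .
    then show ?thesis using dvd_prime_power_cases[OF p] by blast
  qed
  have HR: "H \<in> rcosets H" by (rule H.subgroup_in_rcosets) (rule assms(1))
  have orbH: "orbit ?H ?\<phi> H = {H}"
    using HR H.one_closed H.rcos_const[OF assms(1)] by (auto simp: orbit_def intro!: exI[of _ \<one>])
  have "\<exists>C \<in> rcosets H. C \<noteq> H \<and> orbit ?H ?\<phi> C = {C}"
  proof (rule ccontr)
    assume no: "\<not> ?thesis"
    let ?O = "orbits ?H (rcosets H) ?\<phi>"
    have part: "partition (rcosets H) ?O" by (rule A.orbit_partition)
    have UO: "\<Union> ?O = rcosets H"
      using partition.partition_coverture[OF part] .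
    have finO: "finite ?O" by (rule finite_UnionD) (use UO finR in simp)
    have disj: "pairwise disjnt ?O"
      using part unfolding partition_def pairwise_def disjnt_def by blast
    have "p dvd card Orb" if Orb: "Orb \<in> ?O - {{H}}" for Orb
    proof -
      obtain C where C: "C \<in> rcosets H" "Orb = orbit ?H ?\<phi> C"
        using Orb unfolding orbits_def by blast
      have "C \<in> Orb" using C A.orbit_refl by blast
      then have "card Orb \<noteq> 1"
        using C no Orb orbH by (metis DiffD2 card_1_singletonE insertI1 singletonD)
      then show ?thesis using orbdvd C by blast
    qed
    then have "p dvd (\<Sum>Orb \<in> ?O - {{H}}. card Orb)" by (rule dvd_sum)
    \<comment> \<open>Splitting off the orbit of \<open>H\<close> itself makes the number of cosets
      1 modulo \<open>p\<close>, against \<open>pdvd\<close>.\<close>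
    moreover have "card (rcosets H) = 1 + (\<Sum>Orb \<in> ?O - {{H}}. card Orb)"
    proof -
      have "{H} \<in> ?O" unfolding orbits_def using orbH[symmetric] HR by blast
      moreover have "card (rcosets H) = sum card ?O"
        using card_Union_disjoint[OF disj] UO finR by (metis Sup_upper finite_subset)
      ultimately show ?thesis using finO by (simp add: sum.remove)
    qed
    ultimately have "p dvd 1" using pdvd by (metis dvd_add_left_iff)
    then show False using p by (metis not_prime_unit)
  qed
  then obtain C where C: "C \<in> rcosets H" "C \<noteq> H" "orbit ?H ?\<phi> C = {C}" by blast
  then obtain g where g: "g \<in> carrier G" "C = H #> g" by (auto simp: RCOSETS_def)
  have gH: "g \<notin> H" using g C(2) H.rcos_const[OF assms(1)] by blast
  have conj: "g \<otimes> h \<otimes> inv g \<in> H" if h: "h \<in> H" for h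
  proof -
    \<comment> \<open>The action inverts its argument, so applying it to \<open>inv h\<close>
      multiplies the fixed coset by \<open>h\<close>.\<close>
    have "?\<phi> (inv h) C \<in> orbit ?H ?\<phi> C"
      unfolding orbit_def by (intro CollectI exI[of _ "inv h"] conjI refl) (use h in simp)
    then have "H #> g #> h = H #> g" using C g h by simp
    then have "H #> (g \<otimes> h) = H #> g" using g h H.subset by (simp add: coset_mult_assoc)
    then have "H #> (g \<otimes> h \<otimes> inv g) = H"
      using g h H.subset coset_mult_assoc[of H "g \<otimes> h" "inv g"] coset_mult_assoc[of H g "inv g"]
      by simp
    then show ?thesis
      using g h coset_join1[of H "g \<otimes> h \<otimes> inv g"] H by simp
  qed
  \<comment> \<open>Membership in the normalizer requires that conjugation map \<open>H\<close> onto
    itself; an injective self-map of the finite set \<open>H\<close> is onto.\<close>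
  have "inj_on (\<lambda>h. g \<otimes> h \<otimes> inv g) H"
    using g by (intro inj_onI) simp
  then have "(\<lambda>h. g \<otimes> h \<otimes> inv g) ` H = H"
    using conj fH by (intro endo_inj_surj) auto
  then have "g \<in> normalizer G H"
    using g H.subset by (auto simp: normalizer_def stabilizer_def l_coset_def r_coset_def)
  moreover have "H \<subseteq> normalizer G H"
    using subgroup_in_normalizer[OF H(1)] normal_imp_subgroup subgroup.subset by fastforce
  ultimately show ?thesis using gH by blast
qed

text \<open>Take M maximal among the proper subgroups containing \<open>H\<close>. Its normalizer is
  a strictly larger subgroup, hence all of \<open>G\<close>, so M is normal.\<close>

lemma proper_subgroup_in_proper_normal:
  fixes G (structure)
  assumes "group G" and ord: "order G = p ^ n" and p: "Factorial_Ring.prime p"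
    and H: "subgroup H G" "H \<noteq> carrier G"
  shows "\<exists>M. M \<lhd> G \<and> H \<subseteq> M \<and> M \<noteq> carrier G"
proof -
  interpret group G by fact
  have fin: "finite (carrier G)"
    using ord p order_gt_0_iff_finite prime_gt_0_nat by (metis zero_less_power)
  let ?F = "{K. subgroup K G \<and> K \<noteq> carrier G}"
  have "finite ?F"
    by (rule finite_subset[of _ "Pow (carrier G)"]) (use fin subgroup.subset in auto)
  then have "\<exists>M \<in> ?F. H \<subseteq> M \<and> (\<forall>K \<in> ?F. M \<subseteq> K \<longrightarrow> M = K)"
    by (rule finite_has_maximal2) (use H in simp)
  then obtain M where M: "M \<in> ?F" "H \<subseteq> M" "\<forall>K \<in> ?F. M \<subseteq> K \<longrightarrow> M = K"
    by (elim bexE conjE)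
  have sM: "subgroup M G" using M by simp
  have "M \<subset> normalizer G M"
    using M by (intro proper_subgroup_less_normalizer[OF assms(1) ord p]) auto
  moreover have "subgroup (normalizer G M) G"
    using sM by (simp add: normalizer_imp_subgroup subgroup.subset)
  ultimately have "normalizer G M = carrier G" using M(3) by blast
  then have "M \<lhd> G" using subgroup_in_normalizer[OF sM] by simp
  then show ?thesis using M by blast
qed

section \<open>From generation to invariable generation\<close>

text \<open>If some conjugates generated a proper subgroup, a proper normal subgroup would contain
  them. Normality lets the conjugation be undone, so it would contain \<open>S\<close> as well and
  therefore all of \<open>G\<close>.\<close>

lemma p_group_generating_set_invariably_generates:
  fixes G (structure)
  assumes "group G" "order G = p ^ n" "Factorial_Ring.prime p"
    and S: "S \<subseteq> carrier G" "generate G S = carrier G"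
  shows "invariably_generates G S"
  unfolding invariably_generates_def
proof (intro conjI ballI S(1))
  interpret group G by fact
  fix g assume g: "g \<in> S \<rightarrow> carrier G"
  let ?T = "(\<lambda>s. group_conj G s (g s)) ` S"
  have T: "?T \<subseteq> carrier G" using g S(1) by (auto simp: group_conj_def Pi_iff)
  show "generate G ?T = carrier G"
  proof (rule ccontr)
    assume "generate G ?T \<noteq> carrier G"
    then obtain M where M: "M \<lhd> G" "generate G ?T \<subseteq> M" "M \<noteq> carrier G"
      using proper_subgroup_in_proper_normal[OF assms(1-3) generate_is_subgroup[OF T]] by blast
    have "S \<subseteq> M"
    proof
      fix s assume s: "s \<in> S"
      have c: "s \<in> carrier G" "g s \<in> carrier G" using s g S(1) by auto
      have "group_conj G s (g s) \<in> M" using s M(2) by (auto intro: generate.incl)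
      then have "g s \<otimes> group_conj G s (g s) \<otimes> inv (g s) \<in> M"
        using M(1) c normal_inv_iff by blast
      moreover have "g s \<otimes> group_conj G s (g s) \<otimes> inv (g s) = s"
        using c by (simp add: group_conj_def m_assoc) (simp add: m_assoc[symmetric])
      ultimately show "s \<in> M" by simp
    qed
    then have "generate G S \<subseteq> M"
      using M(1) generate_subgroup_incl normal_imp_subgroup by blast
    then show False using S(2) M normal_imp_subgroup subgroup.subset by blast
  qed
qed

lemma comm_group_invariably_generates_iff:
  fixes G (structure)
  assumes "comm_group G"
  shows "invariably_generates G S \<longleftrightarrow> S \<subseteq> carrier G \<and> generate G S = carrier G"
proof -
  interpret comm_group G by fact
  have "group_conj G s g = s" if "s \<in> carrier G" "g \<in> carrier G" for s g
    using that by (simp add: group_conj_def m_assoc m_comm[of s g] inv_solve_left')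
  then have "(\<lambda>s. group_conj G s (g s)) ` S = S"
    if "S \<subseteq> carrier G" "g \<in> S \<rightarrow> carrier G" for g
    using that by (force simp: Pi_iff image_iff subset_iff)
  \<comment> \<open>One admissible choice of conjugators is needed to pass from the universally
    quantified condition to generation by \<open>S\<close> itself.\<close>
  moreover have "(\<lambda>s. \<one>) \<in> S \<rightarrow> carrier G" by simp
  ultimately show ?thesis unfolding invariably_generates_def by (metis (no_types, lifting))
qed

section \<open>Elementary abelian 2-groups and the value of \<open>d_I\<close>\<close>

text \<open>Adjoining x to a subgroup K adds at most the coset xK, since x commutes with K and has
  trivial square. Finiteness is part of the induction because \<open>G\<close> may be infinite here
  and \<open>card\<close> is 0 on infinite sets.\<close>

lemma card_generate_le_exponent_two:
  fixes G (structure)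
  assumes "comm_group G" and sq: "\<And>x. x \<in> carrier G \<Longrightarrow> x \<otimes> x = \<one>"
    and "finite S" "S \<subseteq> carrier G"
  shows "finite (generate G S) \<and> card (generate G S) \<le> 2 ^ card S"
  using assms(3,4)
proof (induction S)
  case empty
  interpret comm_group G by fact
  show ?case by (simp add: generate_empty)
next
  case (insert x S)
  interpret comm_group G by fact
  let ?K = "generate G S"
  have x: "x \<in> carrier G" and S: "S \<subseteq> carrier G" using insert.prems by auto
  have K: "subgroup ?K G" using S by (rule generate_is_subgroup)
  interpret K: subgroup ?K G by (rule K)
  have inv_self: "inv y = y" if "y \<in> carrier G" for y using sq that inv_equality by metis
  \<comment> \<open>Closure of this union under products suffices: every element is its own
    inverse.\<close>
  let ?L = "?K \<union> (\<otimes>) x ` ?K"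
  have gen: "h \<in> ?L" if "h \<in> insert x S" for h
    using that x generate.incl[of _ S G] K.one_closed by (auto intro: image_eqI[of _ _ \<one>])
  have mult: "a \<otimes> b \<in> ?L" if "a \<in> ?L" "b \<in> ?L" for a b
  proof -
    have xx: "x \<otimes> (x \<otimes> c) = c" if "c \<in> carrier G" for c
      using that x sq[OF x] by (simp add: m_assoc[symmetric])
    have ab: "(x \<otimes> a) \<otimes> b = x \<otimes> (a \<otimes> b)" "a \<otimes> (x \<otimes> b) = x \<otimes> (a \<otimes> b)"
      "(x \<otimes> a) \<otimes> (x \<otimes> b) = a \<otimes> b" if "a \<in> ?K" "b \<in> ?K" for a b
      using that x xx[of "a \<otimes> b"] by (simp_all add: m_assoc m_lcomm[of a x b])
    show ?thesis using that
      by (elim UnE imageE) (use ab K.m_closed in simp_all)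
  qed
  have "?L \<supseteq> generate G (insert x S)"
  proof
    fix a assume "a \<in> generate G (insert x S)"
    then show "a \<in> ?L"
    proof induction
      case one show ?case by simp
    next
      case (incl h) then show ?case by (rule gen)
    next
      case (inv h)
      then have "inv h = h" using inv_self x S by blast
      then show ?case using inv gen by simp
    next
      case (eng a b) then show ?case by (intro mult)
    qed
  qed
  moreover have fK: "finite ?K" and cK: "card ?K \<le> 2 ^ card S"
    using insert.IH[OF S] by auto
  moreover have "card ?L \<le> card ?K + card ?K"
    using fK card_Un_le[of ?K "(\<otimes>) x ` ?K"] card_image_le[OF fK, of "(\<otimes>) x"] by linarith
  ultimately show ?case
    using insert.hyps card_mono[of ?L "generate G (insert x S)"]
    by (auto intro: finite_subset)
qed

lemma d_I_le: "invariably_generates G S \<Longrightarrow> d_I G \<le> card S"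
  unfolding d_I_def by (rule Least_le) blast

text \<open>\<open>LEAST\<close> is informative only if some number qualifies, so an invariably
  generating set must be supplied.\<close>

lemma d_I_attained:
  assumes "invariably_generates G S"
  obtains T where "invariably_generates G T" "card T = d_I G"
  using LeastI_ex[of "\<lambda>n. \<exists>S. invariably_generates G S \<and> card S = n"] assms
  unfolding d_I_def by blast

text \<open>Trivial squares make every element its own inverse, so xy equals its inverse, which is
  yx. One equation thus replaces commutativity and the condition on orders.\<close>

lemma elementary_abelian_two_iff:
  fixes G (structure)
  assumes "group G"
  shows "elementary_abelian 2 G \<longleftrightarrow> (\<forall>x \<in> carrier G. x \<otimes> x = \<one>)"
proof -
  interpret group G by fact
  show ?thesis
  proof
    assume el: "elementary_abelian 2 G"
    show "\<forall>x \<in> carrier G. x \<otimes> x = \<one>"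
    proof
      fix x assume x: "x \<in> carrier G"
      show "x \<otimes> x = \<one>"
      proof (cases "x = \<one>")
        case False
        then have "ord x = 2" using el x by (simp add: elementary_abelian_def)
        then have "x [^] (2::nat) = \<one>" using x pow_ord_eq_1 by metis
        then show ?thesis using x by (simp add: numeral_2_eq_2)
      qed simp
    qed
  next
    assume sq: "\<forall>x \<in> carrier G. x \<otimes> x = \<one>"
    have inv_self: "inv x = x" if "x \<in> carrier G" for x using sq that inv_equality by metis
    have "comm_group G"
    proof (rule group_comm_groupI)
      fix x y assume "x \<in> carrier G" "y \<in> carrier G"
      then show "x \<otimes> y = y \<otimes> x" using inv_self inv_mult_group by (metis m_closed)
    qed
    moreover have "ord x = 2" if x: "x \<in> carrier G" "x \<noteq> \<one>" for x
    proof -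
      have "x [^] (2::nat) = \<one>" using x sq by (simp add: numeral_2_eq_2)
      then have "ord x dvd 2" using x pow_eq_id by blast
      moreover have "ord x \<noteq> 1" using x ord_eq_1 by blast
      ultimately show ?thesis using prime_nat_iff two_is_prime_nat by blast
    qed
    ultimately show "elementary_abelian 2 G" by (simp add: elementary_abelian_def)
  qed
qed

text \<open>Two bounds meet: a generating set grown from the empty set gives
  \<open>2 ^ d_I G <= order G\<close>, and a generating set of minimal size T gives
  \<open>order G <= 2 ^ card T\<close>.\<close>

lemma order_elementary_abelian_two:
  fixes G (structure)
  assumes fin: "finite (carrier G)" and el: "elementary_abelian 2 G"
  shows "order G = 2 ^ d_I G"
proof -
  interpret comm_group G using el by (simp add: elementary_abelian_def)
  have cg: "comm_group G" by (rule comm_group_axioms)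
  have sq: "x \<otimes> x = \<one>" if "x \<in> carrier G" for x
    using el elementary_abelian_two_iff[OF group_axioms] that by blast
  obtain S where S: "S \<subseteq> carrier G" "generate G S = carrier G" "2 ^ card S \<le> order G"
    using extend_to_generating_set[OF group_axioms fin, of "{}"] by (auto simp: generate_empty)
  then have igS: "invariably_generates G S" using comm_group_invariably_generates_iff[OF cg] by blast
  then obtain T where T: "invariably_generates G T" "card T = d_I G" by (rule d_I_attained)
  then have gT: "T \<subseteq> carrier G" "generate G T = carrier G"
    using comm_group_invariably_generates_iff[OF cg] by blast+
  have "order G \<le> 2 ^ card T"
    using card_generate_le_exponent_two[OF cg sq finite_subset[OF gT(1) fin] gT(1)] gT(2)
    by (simp add: order_def)
  moreover have "2 ^ d_I G \<le> order G"
    using S(3) d_I_le[OF igS] by (meson le_trans one_le_numeral power_increasing)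
  ultimately show ?thesis using T(2) by simp
qed

lemma elementary_abelian_two_if_order:
  fixes G (structure)
  assumes "group G" and ord: "order G = 2 ^ d_I G"
  shows "elementary_abelian 2 G"
proof (rule ccontr)
  interpret group G by fact
  have fin: "finite (carrier G)"
    using ord order_gt_0_iff_finite by (metis zero_less_power zero_less_numeral)
  assume "\<not> elementary_abelian 2 G"
  then obtain x where x: "x \<in> carrier G" "x \<otimes> x \<noteq> \<one>"
    using elementary_abelian_two_iff[OF assms(1)] by blast
  have "group.ord G x dvd 2 ^ d_I G" using ord_dvd_group_order[OF x(1)] ord by simp
  then obtain k where k: "group.ord G x = 2 ^ k"
    using divides_primepow_nat[OF two_is_prime_nat] by blast
  \<comment> \<open>This excludes the exponents 0 and 1 together, leaving order at least 4.\<close>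
  have "\<not> group.ord G x dvd 2"
    using x pow_eq_id[OF x(1), of 2] by (simp add: numeral_2_eq_2)
  then have "k \<ge> 2" using k le_imp_power_dvd[of k 1 "2::nat"] by (cases "k \<le> 1") auto
  then have "(2::nat) ^ 2 \<le> group.ord G x" unfolding k by (intro power_increasing) auto
  then have "4 \<le> card (generate G {x})" using generate_pow_card[OF x(1)] by simp
  \<comment> \<open>The factor 2 on the right is \<open>2 ^ card {x}\<close>; against the factor 4
    on the left it yields one generator fewer than \<open>d_I G\<close>.\<close>
  moreover obtain S where S: "S \<subseteq> carrier G" "generate G S = carrier G"
    "2 ^ card S * card (generate G {x}) \<le> 2 * order G"
    using extend_to_generating_set[OF assms(1) fin, of "{x}"] x(1) by auto
  ultimately have "2 ^ card S * 4 \<le> 2 * order G"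
    by (meson le_trans mult_le_mono2)
  then have "2 * 2 ^ card S \<le> (2::nat) ^ d_I G" using ord by simp
  moreover have "(2::nat) ^ card S > 0" by simp
  ultimately have "(2::nat) ^ card S < 2 ^ d_I G" by linarith
  then have "card S < d_I G" by (rule power_less_imp_less_exp[rotated]) simp
  \<comment> \<open>\<open>S\<close> generates only in the ordinary sense; invariable generation
    follows because \<open>G\<close> is a 2-group.\<close>
  moreover have "d_I G \<le> card S"
    using p_group_generating_set_invariably_generates[OF assms(1) ord two_is_prime_nat S(1,2)]
    by (rule d_I_le)
  ultimately show False by simp
qed

theorem mainTheorem2:
  fixes G :: "('a, 'b) monoid_scheme"
  assumes "group G" and "finite (carrier G)"
  shows "real (d_I G) = log 2 (real (order G)) \<longleftrightarrow> elementary_abelian 2 G"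
proof -
  \<comment> \<open>\<open>log\<close> inverts exponentiation only at positive arguments.\<close>
  have pos: "order G > 0"
    using assms group.is_monoid monoid.order_gt_0_iff_finite by blast
  have "real (d_I G) = log 2 (real (order G)) \<longleftrightarrow> real (order G) = real (2 ^ d_I G)"
    using pos by (auto simp: powr_realpow[symmetric])
  also have "\<dots> \<longleftrightarrow> order G = 2 ^ d_I G" by (rule of_nat_eq_iff)
  also have "\<dots> \<longleftrightarrow> elementary_abelian 2 G"
    using elementary_abelian_two_if_order order_elementary_abelian_two assms by blast
  finally show ?thesis .
qed

end
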